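(* Let $n,\ell\ge1$. Define $\psi_{\mathbb{C}}:\mathbb{C}^{n\times\ell}\to\mathbb{C}^{\ell\times\ell}$ by $$\psi_{\mathbb{C}}\left([a_1\ a_2\ \cdots\ a_\ell]\right)=\phi_{\mathbb{C}}\left([a_1-\overline{a}\ \ a_2-\overline{a}\ \cdots\ a_\ell-\overline{a}]\right),$$ where $\overline{a}=\frac1\ell(a_1+a_2+\cdots+a_\ell)$ is the average of the columns and $\phi_{\mathbb{C}}(A)=\sqrt{A^\star A}$. Then $$d_{\mathrm{F}(n)}(A,B)\leq d(\psi_{\mathbb{C}}(A),\psi_{\mathbb{C}}(B))\leq\sqrt2\,d_{\mathrm{F}(n)}(A,B)$$ for all $A,B\in\mathbb{C}^{n\times\ell}$. The image of $\psi_{\mathbb{C}}$ is contained in a real subspace of $\mathbb{C}^{\ell\times\ell}$ of real dimension $(\ell-1)^2$.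
   Context: $B^\star$ is the conjugate transpose of $B$. On complex matrix spaces, $\langle A,B\rangle=\operatorname{trace}(AB^\star)$, $\|A\|=\sqrt{\langle A,A\rangle}$ and $d(A,B)=\|A-B\|$. For a positive semi-definite hermitian matrix $M$, $\sqrt M$ is the unique positive semi-definite hermitian matrix whose square is $M$. The complex euclidean group $\mathrm{F}(n)$ consists of all pairs $g=(P,q)$ with $P\in\mathrm{U}(n)$, $q\in\mathbb{C}^n$, acting on $\mathbb{C}^n$ by $g\cdot a=Pa+q$ and on $\mathbb{C}^{n\times\ell}$ columnwise: $g\cdot[a_1\ \cdots\ a_\ell]=[g\cdot a_1\ \cdots\ g\cdot a_\ell]$. We write $d_{\mathrm{F}(n)}(A,B)=\min_{g\in\mathrm{F}(n)}\|g\cdot A-B\|$. *)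

theory Defs
  imports "HOL-Analysis.Analysis"
begin

text \<open>
  A complex \<open>n \<times> \<ell>\<close> matrix is an element of type \<open>complex ^ 'l ^ 'n\<close>: \<open>'n\<close> indexes the rows
  and \<open>'l\<close> the columns.
\<close>

definition conj_transpose :: "complex ^ 'm ^ 'n \<Rightarrow> complex ^ 'n ^ 'm" where
  "conj_transpose A = (\<chi> i j. cnj (A $ j $ i))"

definition mat_inner :: "complex ^ 'm ^ 'n \<Rightarrow> complex ^ 'm ^ 'n \<Rightarrow> complex" where
  "mat_inner A B = trace (A ** conj_transpose B)"

text \<open>The number \<open>mat_inner A A\<close> is real, so taking \<open>Re\<close> only changes its type.\<close>

definition mat_norm :: "complex ^ 'm ^ 'n \<Rightarrow> real" where
  "mat_norm A = sqrt (Re (mat_inner A A))"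

definition mat_dist :: "complex ^ 'm ^ 'n \<Rightarrow> complex ^ 'm ^ 'n \<Rightarrow> real" where
  "mat_dist A B = mat_norm (A - B)"

lemma mat_inner_self: "mat_inner A A = of_real ((norm A)\<^sup>2)"
  by (simp add: mat_inner_def trace_def matrix_matrix_mult_def conj_transpose_def norm_vec_def
      L2_set_def sum_nonneg complex_norm_square del: of_real_power)

lemma mat_norm_eq_norm: "mat_norm A = norm A"
  by (simp add: mat_norm_def mat_inner_self)

definition hermitian :: "complex ^ 'n ^ 'n \<Rightarrow> bool" where
  "hermitian M \<longleftrightarrow> conj_transpose M = M"

text \<open>For hermitian \<open>M\<close> the quadratic form below takes only real values.\<close>

definition psd_hermitian :: "complex ^ 'n ^ 'n \<Rightarrow> bool" where
  "psd_hermitian M \<longleftrightarrow> hermitian M \<and> (\<forall>x. 0 \<le> Re (\<Sum>i\<in>UNIV. cnj (x $ i) * (M *v x) $ i))"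

definition psd_sqrt :: "complex ^ 'n ^ 'n \<Rightarrow> complex ^ 'n ^ 'n" where
  "psd_sqrt M = (THE S. psd_hermitian S \<and> S ** S = M)"

definition unitary_group :: "(complex ^ 'n ^ 'n) set" where
  "unitary_group = {P. P ** conj_transpose P = mat 1 \<and> conj_transpose P ** P = mat 1}"

definition complex_euclidean_group :: "((complex ^ 'n ^ 'n) \<times> (complex ^ 'n)) set" where
  "complex_euclidean_group = unitary_group \<times> UNIV"

definition vec_action :: "(complex ^ 'n ^ 'n) \<times> (complex ^ 'n) \<Rightarrow> complex ^ 'n \<Rightarrow> complex ^ 'n" where
  "vec_action g a = fst g *v a + snd g"

definition mat_action ::
  "(complex ^ 'n ^ 'n) \<times> (complex ^ 'n) \<Rightarrow> complex ^ 'l ^ 'n \<Rightarrow> complex ^ 'l ^ 'n" where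
  "mat_action g A = (\<chi> i j. vec_action g (column j A) $ i)"

text \<open>
  \<open>LEAST\<close> denotes a genuine minimum: on the reals it is unspecified, rather than an infimum,
  if the minimum is not attained.
\<close>

definition euclidean_dist :: "complex ^ 'l ^ 'n \<Rightarrow> complex ^ 'l ^ 'n \<Rightarrow> real" where
  "euclidean_dist A B =
    (LEAST r. \<exists>g\<in>complex_euclidean_group. r = mat_norm (mat_action g A - B))"

definition column_mean :: "complex ^ 'l ^ 'n \<Rightarrow> complex ^ 'n" where
  "column_mean A = (1 / real CARD('l)) *\<^sub>R (\<Sum>j\<in>UNIV. column j A)"

definition phi_C :: "complex ^ 'l ^ 'n \<Rightarrow> complex ^ 'l ^ 'l" where
  "phi_C A = psd_sqrt (conj_transpose A ** A)"

definition psi_C :: "complex ^ 'l ^ 'n \<Rightarrow> complex ^ 'l ^ 'l" where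
  "psi_C A = phi_C (\<chi> i j. (column j A - column_mean A) $ i)"

end

theory Submission
  imports Defs
begin

text \<open>
  The factor \<open>U\<close> of a polar decomposition \<open>A = U \<phi>(A)\<close> comes from maximizing a real linear
  functional over the compact unitary group, and positive semi-definite matrices are factored as
  \<open>Y Y\<^sup>\<star>\<close>; no spectral theory is needed. For the lower bound, \<open>\<langle>\<phi>(A), \<phi>(B)\<rangle>\<close> is the value of
  \<open>Re \<langle>W A, B\<rangle>\<close> at the contraction \<open>W = V U\<^sup>\<star>\<close>, hence at most its maximum over contractions, which is
  attained at a unitary matrix. The upper bound is the Araki-Yamagami inequality, here a consequence
  of Cauchy-Schwarz. Subtracting the column mean is right multiplication by an orthogonal
  projection, which eliminates the translations.
\<close>

section \<open>Algebra of the conjugate transpose and of matrix products\<close>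

notation conj_transpose ("_\<^sup>\<star>" [1000] 1000)

lemma conj_transpose_conj_transpose [simp]: "A\<^sup>\<star>\<^sup>\<star> = A"
  by (simp add: conj_transpose_def vec_eq_iff)

lemma conj_transpose_mult: "(A ** B)\<^sup>\<star> = B\<^sup>\<star> ** A\<^sup>\<star>"
  by (simp add: conj_transpose_def matrix_matrix_mult_def vec_eq_iff mult.commute)

lemma conj_transpose_mat_1 [simp]: "(mat 1)\<^sup>\<star> = mat 1"
  by (simp add: conj_transpose_def mat_def vec_eq_iff)

lemma conj_transpose_diff: "(A - B)\<^sup>\<star> = A\<^sup>\<star> - B\<^sup>\<star>"
  by (simp add: conj_transpose_def vec_eq_iff)

lemma conj_transpose_0 [simp]: "0\<^sup>\<star> = 0"
  by (simp add: conj_transpose_def vec_eq_iff)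

lemma matrix_diff_ldistrib: "A ** (B - C) = A ** B - A ** C" for A :: "'a::ring_1^'n^'m"
  by (simp add: matrix_matrix_mult_def vec_eq_iff algebra_simps sum_subtractf)

lemma matrix_add_rdistrib: "(A + B) ** C = A ** C + B ** C" for A :: "'a::semiring_1^'n^'m"
  by (simp add: matrix_matrix_mult_def vec_eq_iff distrib_right sum.distrib)

lemma matrix_diff_rdistrib: "(A - B) ** C = A ** C - B ** C" for A :: "'a::ring_1^'n^'m"
  by (simp add: matrix_matrix_mult_def vec_eq_iff algebra_simps sum_subtractf)

lemma matrix_mult_0_left [simp]: "0 ** A = 0" for A :: "'a::semiring_1^'n^'m"
  by (simp add: matrix_matrix_mult_def vec_eq_iff)

lemma matrix_mult_0_right [simp]: "A ** 0 = 0" for A :: "'a::semiring_1^'n^'m"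
  by (simp add: matrix_matrix_mult_def vec_eq_iff)

lemma row_matrix_mult: "(A ** B) $ i = A $ i v* B" for A :: "complex^'m^'n"
  by (simp add: matrix_matrix_mult_def vector_matrix_mult_def vec_eq_iff mult.commute)

section \<open>The real inner product of complex matrices and adjoints of multiplication
  maps\<close>

lemma inner_complex_Re: "z \<bullet> w = Re (cnj z * w)" for z w :: complex
  by (simp add: inner_complex_def)

text \<open>On complex vectors \<open>\<bullet>\<close> is the real part of the hermitian inner
  product. Row vectors are used because \<open>A $ i\<close> is a row, so that matrix statements
  follow row by row.\<close>

lemma inner_vector_matrix_mult: "(x v* A) \<bullet> y = x \<bullet> (y v* A\<^sup>\<star>)"
proof -
  have "(x v* A) \<bullet> y = Re (\<Sum>j\<in>UNIV. \<Sum>i\<in>UNIV. cnj (x $ i) * (cnj (A $ i $ j) * y $ j))"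
    by (simp add: inner_vec_def inner_complex_Re vector_matrix_mult_def sum_distrib_right
        sum_distrib_left mult_ac del: times_complex.sel)
  also have "\<dots> = Re (\<Sum>i\<in>UNIV. \<Sum>j\<in>UNIV. cnj (x $ i) * (cnj (A $ i $ j) * y $ j))"
    by (subst sum.swap) (rule refl)
  also have "\<dots> = x \<bullet> (y v* A\<^sup>\<star>)"
    by (simp add: inner_vec_def inner_complex_Re vector_matrix_mult_def sum_distrib_left
        conj_transpose_def mult_ac del: times_complex.sel)
  finally show ?thesis .
qed

lemma inner_matrix_mult_right: "(X ** W) \<bullet> Y = X \<bullet> (Y ** W\<^sup>\<star>)"
  for X :: "complex^'m^'n"
  by (simp add: inner_vec_def[where 'b='n] row_matrix_mult inner_vector_matrix_mult)

lemma inner_conj_transpose: "A\<^sup>\<star> \<bullet> B\<^sup>\<star> = A \<bullet> B"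
  by (simp add: inner_vec_def conj_transpose_def inner_complex_def)
    (subst sum.swap, rule refl)

text \<open>Conjugate transposition preserves the inner product and exchanges left and right
  multiplication.\<close>

lemma inner_matrix_mult_left: "(P ** X) \<bullet> Y = X \<bullet> (P\<^sup>\<star> ** Y)"
  using inner_matrix_mult_right[of "X\<^sup>\<star>" "P\<^sup>\<star>" "Y\<^sup>\<star>"]
    inner_conj_transpose[of "P ** X" Y] inner_conj_transpose[of X "P\<^sup>\<star> ** Y"]
  by (simp add: conj_transpose_mult)

lemma norm_conj_transpose [simp]: "norm (A\<^sup>\<star>) = norm A"
  by (simp add: norm_eq_sqrt_inner inner_conj_transpose)

subsection \<open>Contractions\<close>

definition contraction :: "complex^'m^'n \<Rightarrow> bool" where
  "contraction W \<longleftrightarrow> (\<forall>x. norm (x v* W) \<le> norm x)"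

lemma contraction_mult: "contraction V \<Longrightarrow> contraction W \<Longrightarrow> contraction (V ** W)"
  unfolding contraction_def by (metis order_trans vector_matrix_mul_assoc)

text \<open>An operator and its adjoint have the same norm: the square of \<open>norm ?y\<close> is
  the inner product of \<open>x\<close> with \<open>?y v* W\<close>, and after Cauchy-Schwarz one
  factor \<open>norm ?y\<close> cancels.\<close>

lemma contraction_conj_transpose:
  assumes "contraction W" shows "contraction (W\<^sup>\<star>)"
  unfolding contraction_def
proof
  fix x
  let ?y = "x v* W\<^sup>\<star>"
  have "norm ?y * norm ?y = x \<bullet> (?y v* W)"
    using inner_vector_matrix_mult[of x "W\<^sup>\<star>" ?y]
    by (simp add: dot_square_norm power2_eq_square)
  also have "\<dots> \<le> norm x * norm (?y v* W)"
    by (rule norm_cauchy_schwarz)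
  also have "\<dots> \<le> norm x * norm ?y"
    using assms by (simp add: contraction_def mult_left_mono)
  finally have "norm ?y * norm ?y \<le> norm x * norm ?y" .
  then show "norm ?y \<le> norm x"
    by (cases "norm ?y = 0") (auto dest: mult_right_le_imp_le)
qed

lemma contraction_isometry:
  assumes "W ** W\<^sup>\<star> = mat 1" shows "contraction W"
  unfolding contraction_def
proof
  fix x
  have "(x v* W) \<bullet> (x v* W) = x \<bullet> x"
    by (simp add: inner_vector_matrix_mult vector_matrix_mul_assoc assms)
  then show "norm (x v* W) \<le> norm x"
    by (simp add: norm_eq_sqrt_inner)
qed

lemma norm_mult_contraction:
  assumes "contraction W" shows "norm (X ** W) \<le> norm X"
  unfolding norm_vec_def[where 'b='c] 
  using assms by (auto simp: norm_vec_def row_matrix_mult contraction_def intro!: L2_set_mono)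

subsection \<open>Positive semi-definite matrices\<close>

text \<open>The sesquilinear form, conjugate linear in \<open>x\<close>, whose diagonal is the
  quadratic form in \<open>psd_hermitian_def\<close>.\<close>

definition hform :: "complex^'n^'n \<Rightarrow> complex^'n \<Rightarrow> complex^'n \<Rightarrow> complex" where
  "hform M x y = (\<Sum>i\<in>UNIV. cnj (x $ i) * (M *v y) $ i)"

lemma psd_hermitian_hform: "psd_hermitian M \<longleftrightarrow> M\<^sup>\<star> = M \<and> (\<forall>x. 0 \<le> Re (hform M x x))"
  by (simp add: psd_hermitian_def hermitian_def hform_def)

lemma hermitian_nth: "M\<^sup>\<star> = M \<Longrightarrow> cnj (M $ i $ j) = M $ j $ i"
  by (drule arg_cong[of _ _ "\<lambda>A. A $ j $ i"]) (simp add: conj_transpose_def)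

lemma hform_add_left: "hform M (x + y) z = hform M x z + hform M y z"
  by (simp add: hform_def ring_distribs sum.distrib)

lemma hform_add_right: "hform M x (y + z) = hform M x y + hform M x z"
  by (simp add: hform_def ring_distribs sum.distrib matrix_vector_right_distrib)

lemma matrix_vector_mult_axis: "(M *v axis i t) $ j = M $ j $ i * t" for M :: "complex^'n^'m"
  by (simp add: matrix_vector_mult_def axis_def if_distrib[of "(*) _"] cong: if_cong)

lemma hform_axis_left: "hform M (axis i t) y = cnj t * (M *v y) $ i"
  by (simp add: hform_def axis_def if_distrib[of cnj] if_distrib[of "\<lambda>z. z * _"] cong: if_cong)

lemma hform_axis_right:
  assumes "M\<^sup>\<star> = M" shows "hform M x (axis i t) = t * cnj ((M *v x) $ i)"
  unfolding hform_def matrix_vector_mult_axis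
  by (simp add: matrix_vector_mult_def sum_distrib_left hermitian_nth[OF assms] mult_ac)

lemma psd_hermitian_diag:
  assumes "psd_hermitian M" shows "M $ i $ i = of_real (Re (M $ i $ i))" "0 \<le> Re (M $ i $ i)"
proof -
  have h: "M\<^sup>\<star> = M" and p: "0 \<le> Re (hform M (axis i 1) (axis i 1))"
    using assms by (auto simp: psd_hermitian_hform)
  have "cnj (M $ i $ i) = M $ i $ i"
    by (rule hermitian_nth[OF h])
  then show "M $ i $ i = of_real (Re (M $ i $ i))"
    by (simp add: complex_eq_iff)
  show "0 \<le> Re (M $ i $ i)"
    using p by (simp add: hform_axis_left matrix_vector_mult_axis)
qed

text \<open>Cauchy-Schwarz for the form of \<open>M\<close> between a basis vector and
  \<open>x\<close>, since \<open>(M *v x) $ i\<close> is \<open>hform M (axis i 1) x\<close>. Along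
  a line through \<open>x\<close> the form is a polynomial in \<open>s\<close> without negative
  values.\<close>

lemma psd_hermitian_cauchy_schwarz:
  assumes "psd_hermitian M"
  shows "(cmod ((M *v x) $ i))\<^sup>2 \<le> Re (M $ i $ i) * Re (hform M x x)"
proof -
  define w where "w = (M *v x) $ i"
  define d where "d = Re (M $ i $ i)"
  define q where "q = Re (hform M x x)"
  have h: "M\<^sup>\<star> = M" and p: "\<And>x. 0 \<le> Re (hform M x x)"
    using assms by (auto simp: psd_hermitian_hform)
  have "d \<ge> 0" and Mii: "M $ i $ i = of_real d"
    using psd_hermitian_diag[OF assms, of i] by (auto simp: d_def)
  \<comment> \<open>The factor \<open>w\<close> in the direction makes both cross terms equal to the
    real number \<open>s * (cmod w)\<^sup>2\<close>.\<close>
  have key: "0 \<le> q + 2 * s * (cmod w)\<^sup>2 + s\<^sup>2 * (cmod w)\<^sup>2 * d" for s :: real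
  proof -
    have "hform M (x + axis i (of_real s * w)) (x + axis i (of_real s * w))
        = hform M x x + 2 * of_real s * (w * cnj w) + of_real (s\<^sup>2) * (w * cnj w) * of_real d"
      by (simp add: hform_add_left hform_add_right hform_axis_left hform_axis_right[OF h]
          matrix_vector_mult_axis Mii w_def[symmetric] power2_eq_square algebra_simps)
    also have "Re \<dots> = q + 2 * s * (cmod w)\<^sup>2 + s\<^sup>2 * (cmod w)\<^sup>2 * d"
      by (simp add: q_def complex_norm_square[symmetric] del: of_real_power flip: of_real_mult)
    finally show ?thesis
      using p[of "x + axis i (of_real s * w)"] by simp
  qed
  show ?thesis
  proof (cases "d = 0")
    case True
    have "w = 0"
    proof (rule ccontr)
      assume "w \<noteq> 0"
      \<comment> \<open>With \<open>d = 0\<close> the polynomial is affine in \<open>s\<close>; the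
        chosen \<open>s\<close> gives it the value -1.\<close>
      then have "0 \<le> q - (q + 1)"
        using key[of "- (q + 1) / (2 * (cmod w)\<^sup>2)"] True by (simp add: field_simps)
      then show False by simp
    qed
    with True show ?thesis by (simp add: w_def[symmetric] d_def[symmetric])
  next
    case False
    with \<open>d \<ge> 0\<close> have "d > 0" by simp
    \<comment> \<open>The polynomial is smallest at \<open>s = - 1 / d\<close>.\<close>
    have "0 \<le> q - (cmod w)\<^sup>2 / d"
      using key[of "- 1 / d"] \<open>d > 0\<close> by (simp add: power2_eq_square field_simps)
    with \<open>d > 0\<close> show ?thesis
      by (simp add: field_simps w_def[symmetric] d_def[symmetric] q_def[symmetric])
  qed
qed

lemma hform_mult_conj_transpose:
  fixes Y :: "complex^'m^'n"
  shows "hform (Y ** Y\<^sup>\<star>) x x = (\<Sum>k\<in>UNIV. of_real ((cmod ((Y\<^sup>\<star> *v x) $ k))\<^sup>2))"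
proof -
  have "hform (Y ** Y\<^sup>\<star>) x x = (\<Sum>i\<in>UNIV. \<Sum>k\<in>UNIV. cnj (x $ i) * Y $ i $ k * (Y\<^sup>\<star> *v x) $ k)"
    by (simp add: hform_def matrix_vector_mul_assoc[symmetric])
      (simp add: matrix_vector_mult_def[of Y] sum_distrib_left mult.assoc)
  also have "\<dots> = (\<Sum>k\<in>UNIV. \<Sum>i\<in>UNIV. cnj (x $ i) * Y $ i $ k * (Y\<^sup>\<star> *v x) $ k)"
    by (rule sum.swap)
  also have "\<dots> = (\<Sum>k\<in>UNIV. cnj ((Y\<^sup>\<star> *v x) $ k) * (Y\<^sup>\<star> *v x) $ k)"
    by (simp add: sum_distrib_right[symmetric])
      (simp add: matrix_vector_mult_def conj_transpose_def mult.commute)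
  finally show ?thesis
    by (simp add: complex_norm_square mult.commute del: of_real_power)
qed

lemma psd_hermitian_mult_conj_transpose: "psd_hermitian (Y ** Y\<^sup>\<star>)" for Y :: "complex^'m^'n"
  by (simp add: psd_hermitian_hform conj_transpose_mult hform_mult_conj_transpose sum_nonneg)

text \<open>Where \<open>M $ i $ i = 0\<close>, division by zero makes the subtracted term vanish; this is consistent
  because row \<open>i\<close> of \<open>M\<close> is then already zero.\<close>

lemma psd_hermitian_schur_complement:
  fixes M :: "complex^'n^'n" and i :: 'n
  assumes M: "psd_hermitian M"
  defines "M' \<equiv> \<chi> a b. M $ a $ b - M $ a $ i * M $ i $ b / M $ i $ i"
  shows "psd_hermitian M'" and "M' $ i $ b = 0"
proof -
  define d where "d = Re (M $ i $ i)"
  have h: "M\<^sup>\<star> = M" and p: "\<And>x. 0 \<le> Re (hform M x x)"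
    using M by (auto simp: psd_hermitian_hform)
  have "d \<ge> 0" and Mii: "M $ i $ i = of_real d"
    using psd_hermitian_diag[OF M, of i] by (auto simp: d_def)
  have zero: "M $ i $ b = 0" if "d = 0" for b
    using psd_hermitian_cauchy_schwarz[OF M, of "axis b 1" i] that
    by (simp add: matrix_vector_mult_axis d_def)
  show "M' $ i $ b = 0"
    using zero by (cases "d = 0") (auto simp: M'_def Mii)
  have "M'\<^sup>\<star> = M'"
    by (simp add: M'_def conj_transpose_def vec_eq_iff hermitian_nth[OF h] mult.commute)
  moreover have "0 \<le> Re (hform M' x x)" for x
  proof -
    define w where "w = (M *v x) $ i"
    have *: "(M' *v x) $ a = (M *v x) $ a - M $ a $ i * w / of_real d" for a
      by (simp add: matrix_vector_mult_def M'_def w_def Mii ring_distribs sum_subtractf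
          sum_distrib_left sum_divide_distrib mult_ac)
    have "cnj w = (\<Sum>a\<in>UNIV. cnj (x $ a) * M $ a $ i)"
      by (simp add: w_def matrix_vector_mult_def hermitian_nth[OF h] mult.commute)
    then have "hform M' x x = hform M x x - cnj w * (w / of_real d)"
      by (simp add: hform_def * right_diff_distrib sum_subtractf sum_distrib_right mult.assoc
          times_divide_eq_right[symmetric] del: times_divide_eq_right)
    also have "cnj w * (w / of_real d) = of_real ((cmod w)\<^sup>2 / d)"
      by (simp add: complex_norm_square mult.commute del: of_real_power)
    finally have "Re (hform M' x x) = Re (hform M x x) - (cmod w)\<^sup>2 / d"
      by (simp del: of_real_power)
    \<comment> \<open>For \<open>d = 0\<close> the quotient is 0 and semi-definiteness of
      \<open>M\<close> suffices; otherwise this is Cauchy-Schwarz.\<close>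
    moreover have "(cmod w)\<^sup>2 / d \<le> Re (hform M x x)"
      using psd_hermitian_cauchy_schwarz[OF M, of x i] p[of x] \<open>d \<ge> 0\<close>
      by (cases "d = 0") (simp_all add: divide_le_eq mult.commute w_def d_def)
    ultimately show ?thesis by simp
  qed
  ultimately show "psd_hermitian M'"
    by (simp add: psd_hermitian_hform)
qed

text \<open>Elimination without an order on the indices: each Schur complement splits off a rank-one
  summand and clears one more row. The induction runs over a finite set \<open>I\<close> outside
  which all rows vanish.\<close>

lemma psd_hermitian_cholesky:
  fixes M :: "complex^'n^'n"
  assumes "psd_hermitian M"
  obtains Y :: "complex^'n^'n" where "M = Y ** Y\<^sup>\<star>"
proof -
  have "\<exists>v :: 'n \<Rightarrow> 'n \<Rightarrow> complex. \<forall>a b. M $ a $ b = (\<Sum>i\<in>I. v i a * cnj (v i b))"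
    if "finite I" "psd_hermitian M" "\<And>i b. i \<notin> I \<Longrightarrow> M $ i $ b = 0" for I and M :: "complex^'n^'n"
    using that
  proof (induction I arbitrary: M)
    case empty
    then show ?case by simp
  next
    case (insert i I)
    define M' :: "complex^'n^'n"
      where "M' = (\<chi> a b. M $ a $ b - M $ a $ i * M $ i $ b / M $ i $ i)"
    note schur = psd_hermitian_schur_complement[OF insert.prems(1), of i, folded M'_def]
    have "M' $ j $ b = 0" if "j \<notin> I" for j b
      using that insert.prems(2) schur(2) by (cases "j = i") (auto simp: M'_def)
    then obtain v where v: "\<And>a b. M' $ a $ b = (\<Sum>i\<in>I. v i a * cnj (v i b))"
      using insert.IH[OF schur(1)] by blast
    define d where "d = Re (M $ i $ i)"
    have "d \<ge> 0" and Mii: "M $ i $ i = of_real d"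
      using psd_hermitian_diag[OF insert.prems(1), of i] by (auto simp: d_def)
    \<comment> \<open>For \<open>d = 0\<close> division by zero gives \<open>w = 0\<close>, in
      agreement with the vanishing term subtracted in \<open>M'\<close>.\<close>
    define w where "w = (\<lambda>a. M $ a $ i / of_real (sqrt d))"
    have "M\<^sup>\<star> = M"
      using insert.prems(1) by (simp add: psd_hermitian_hform)
    then have "w a * cnj (w b) = M $ a $ i * M $ i $ b / M $ i $ i" for a b
      using \<open>d \<ge> 0\<close> by (simp add: w_def Mii hermitian_nth flip: of_real_mult)
    then have "M $ a $ b = w a * cnj (w b) + M' $ a $ b" for a b
      by (simp add: M'_def)
    then have "M $ a $ b = (\<Sum>j\<in>insert i I. (v(i := w)) j a * cnj ((v(i := w)) j b))" for a b
      using insert.hyps by (auto simp: v intro!: sum.cong)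
    then show ?case by blast
  qed
  from this[of UNIV M] assms obtain v :: "'n \<Rightarrow> 'n \<Rightarrow> complex"
    where v: "\<And>a b. M $ a $ b = (\<Sum>i\<in>UNIV. v i a * cnj (v i b))"
    by auto
  show ?thesis
  proof
    show "M = (\<chi> a i. v i a) ** (\<chi> a i. v i a)\<^sup>\<star>"
      by (simp add: v vec_eq_iff matrix_matrix_mult_def conj_transpose_def)
  qed
qed

lemma psd_hermitian_congruence:
  fixes G :: "complex^'m^'n"
  assumes "psd_hermitian H" shows "psd_hermitian (G\<^sup>\<star> ** H ** G)"
proof -
  obtain Y :: "complex^'n^'n" where "H = Y ** Y\<^sup>\<star>"
    using psd_hermitian_cholesky[OF assms] .
  then have "G\<^sup>\<star> ** H ** G = (G\<^sup>\<star> ** Y) ** (G\<^sup>\<star> ** Y)\<^sup>\<star>"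
    by (simp add: conj_transpose_mult matrix_mul_assoc)
  then show ?thesis
    by (simp only: psd_hermitian_mult_conj_transpose)
qed

lemma conj_transpose_mult_self_eq_0: "Y\<^sup>\<star> ** Y = 0 \<Longrightarrow> Y = 0" for Y :: "complex^'m^'n"
  using inner_matrix_mult_right[of "mat 1" Y Y] inner_matrix_mult_left[of Y "mat 1" Y]
  by simp

text \<open>For \<open>D = S - T\<close> the mixed terms cancel in \<open>S ** D + D ** T\<close>,
  leaving \<open>S ** S - T ** T = 0\<close>. Paired with \<open>D\<close>, the two summands become
  squared norms, so both vanish; hence \<open>D\<close> is annihilated by \<open>S\<close> and
  \<open>T\<close>, and \<open>D\<^sup>\<star> ** D = 0\<close>. This justifies the definite
  description in \<open>psd_sqrt\<close>.\<close>

lemma psd_hermitian_square_unique: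
  fixes S :: "complex^'n^'n"
  assumes S: "psd_hermitian S" and T: "psd_hermitian T" and eq: "S ** S = T ** T"
  shows "S = T"
proof -
  obtain Y :: "complex^'n^'n" where Y: "S = Y ** Y\<^sup>\<star>" using psd_hermitian_cholesky[OF S] .
  obtain Z :: "complex^'n^'n" where Z: "T = Z ** Z\<^sup>\<star>" using psd_hermitian_cholesky[OF T] .
  define D where "D = S - T"
  have D: "D\<^sup>\<star> = D"
    using S T by (simp add: D_def psd_hermitian_hform conj_transpose_diff)
  have "S ** D + D ** T = 0"
    by (simp add: D_def matrix_diff_ldistrib matrix_diff_rdistrib eq)
  then have "(S ** D) \<bullet> D + (D ** T) \<bullet> D = 0"
    by (metis inner_add_left inner_zero_left)
  moreover have "(S ** D) \<bullet> D = (norm (Y\<^sup>\<star> ** D))\<^sup>2"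
    by (simp add: Y inner_matrix_mult_left power2_norm_eq_inner flip: matrix_mul_assoc)
  moreover have "(D ** T) \<bullet> D = (norm (D ** Z))\<^sup>2"
    by (simp add: Z matrix_mul_assoc inner_matrix_mult_right power2_norm_eq_inner)
  ultimately have "Y\<^sup>\<star> ** D = 0" "D ** Z = 0"
    by (simp_all add: add_nonneg_eq_0_iff)
  then have "S ** D = 0" "D ** T = 0"
    by (simp_all add: Y Z matrix_mul_assoc flip: matrix_mul_assoc[of Y])
  moreover have "T ** D = (D ** T)\<^sup>\<star>"
    using T D by (simp add: conj_transpose_mult psd_hermitian_hform)
  ultimately have "S ** D = 0" "T ** D = 0"
    by simp_all
  then have "D\<^sup>\<star> ** D = 0"
    unfolding D by (simp add: D_def[THEN arg_cong, of "\<lambda>X. X ** D"] matrix_diff_rdistrib)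
  then have "D = 0"
    by (rule conj_transpose_mult_self_eq_0)
  then show ?thesis by (simp add: D_def)
qed

subsection \<open>Polar decomposition\<close>

lemma unitary_group_iff: "P \<in> unitary_group \<longleftrightarrow> P ** P\<^sup>\<star> = mat 1"
  by (auto simp: unitary_group_def matrix_left_right_inverse)

lemma unitary_group_mult: "P \<in> unitary_group \<Longrightarrow> Q \<in> unitary_group \<Longrightarrow> P ** Q \<in> unitary_group"
  unfolding unitary_group_iff conj_transpose_mult
  by (metis matrix_mul_assoc matrix_mul_lid)

lemma compact_unitary_group: "compact (unitary_group :: (complex^'n^'n) set)"
proof -
  have "unitary_group = {P :: complex^'n^'n. \<forall>i j.
      (\<Sum>k\<in>UNIV. P $ i $ k * cnj (P $ j $ k)) = (if i = j then 1 else 0)}"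
    by (auto simp: unitary_group_iff matrix_matrix_mult_def conj_transpose_def mat_def vec_eq_iff)
  also have "closed \<dots>"
    by (intro closed_Collect_all closed_Collect_eq continuous_intros)
  finally have "closed (unitary_group :: (complex^'n^'n) set)" .
  moreover have "bounded (unitary_group :: (complex^'n^'n) set)"
  proof (rule boundedI)
    fix P :: "complex^'n^'n" assume "P \<in> unitary_group"
    then have "P \<bullet> P = mat 1 \<bullet> (mat 1 :: complex^'n^'n)"
      using inner_matrix_mult_right[of "mat 1" P P] by (simp add: unitary_group_iff)
    then show "norm P \<le> norm (mat 1 :: complex^'n^'n)"
      by (simp add: norm_eq_sqrt_inner)
  qed
  ultimately show ?thesis
    by (simp add: compact_eq_bounded_closed)
qed

text \<open>A complex reflection: for a unit vector \<open>v\<close> it multiplies \<open>v\<close>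
  by \<open>z\<close> and fixes the orthogonal complement of \<open>v\<close>.\<close>

definition phase_reflection :: "complex \<Rightarrow> complex^'n \<Rightarrow> complex^'n^'n" where
  "phase_reflection z v = (\<chi> i j. (if i = j then 1 else 0) + (z - 1) * v $ i * cnj (v $ j))"

lemma phase_reflection_unitary:
  assumes "cmod z = 1" "norm v = 1"
  shows "phase_reflection z v \<in> unitary_group"
proof -
  have v: "(\<Sum>k\<in>UNIV. v $ k * cnj (v $ k)) = 1"
  proof -
    have "(\<Sum>k\<in>UNIV. v $ k * cnj (v $ k)) = of_real ((norm v)\<^sup>2)"
      by (simp add: norm_vec_def L2_set_def sum_nonneg complex_norm_square del: of_real_power)
    with assms show ?thesis by simp
  qed
  define c where "c = z - 1"
  have "z * cnj z = 1"
    using assms by (simp add: complex_norm_square[symmetric])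
  \<comment> \<open>This is \<open>(1 + c) * cnj (1 + c) = 1\<close> expanded; the left side is the
    coefficient of \<open>v $ i * cnj (v $ j)\<close> below.\<close>
  then have c: "c + cnj c + c * cnj c = 0"
    by (simp add: c_def algebra_simps)
  have "(\<Sum>k\<in>UNIV. phase_reflection z v $ i $ k * cnj (phase_reflection z v $ j $ k))
      = (if i = j then 1 else 0)" for i j
  proof -
    have "(\<Sum>k\<in>UNIV. phase_reflection z v $ i $ k * cnj (phase_reflection z v $ j $ k))
      = (\<Sum>k\<in>UNIV. (if i = k then (if j = k then 1 else 0) else 0)
          + (if i = k then cnj c * cnj (v $ j) * v $ k else 0)
          + (if j = k then c * v $ i * cnj (v $ k) else 0)
          + c * cnj c * v $ i * cnj (v $ j) * (v $ k * cnj (v $ k)))"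
      unfolding phase_reflection_def c_def[symmetric]
      by (intro sum.cong refl) (simp add: algebra_simps)
    also have "\<dots> = (if i = j then 1 else 0) + (cnj c * cnj (v $ j) * v $ i)
        + (c * v $ i * cnj (v $ j)) + c * cnj c * v $ i * cnj (v $ j)"
      unfolding sum.distrib sum_distrib_left[symmetric] v by (simp cong: if_cong)
    also have "\<dots> = (if i = j then 1 else 0) + (c + cnj c + c * cnj c) * v $ i * cnj (v $ j)"
      by (simp add: algebra_simps)
    also have "c + cnj c + c * cnj c = 0"
      by (rule c)
    finally show ?thesis by simp
  qed
  then show ?thesis
    by (simp add: unitary_group_iff matrix_matrix_mult_def conj_transpose_def mat_def vec_eq_iff)
qed

text \<open>\<open>Q \<bullet> H\<^sup>\<star>\<close> is the real part of the trace of
  \<open>Q ** H\<close>, and the rank-one part of the reflection contributes a multiple of the form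
  of \<open>H\<close> at \<open>v\<close>.\<close>

lemma inner_phase_reflection:
  "phase_reflection z v \<bullet> H\<^sup>\<star> = mat 1 \<bullet> H\<^sup>\<star> + Re ((z - 1) * hform H v v)"
proof -
  have "phase_reflection z v \<bullet> H\<^sup>\<star>
      = (\<Sum>i\<in>UNIV. \<Sum>j\<in>UNIV. (mat 1 $ i $ j) \<bullet> (H\<^sup>\<star> $ i $ j)
          + Re ((z - 1) * (cnj (v $ j) * (H $ j $ i * v $ i))))"
    by (simp add: inner_vec_def phase_reflection_def inner_add_left mat_def inner_complex_def
        conj_transpose_def algebra_simps)
  also have "\<dots> = mat 1 \<bullet> H\<^sup>\<star>
      + Re ((z - 1) * (\<Sum>i\<in>UNIV. \<Sum>j\<in>UNIV. cnj (v $ j) * (H $ j $ i * v $ i)))"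
    by (simp add: inner_vec_def sum.distrib sum_distrib_left del: times_complex.sel)
  also have "(\<Sum>i\<in>UNIV. \<Sum>j\<in>UNIV. cnj (v $ j) * (H $ j $ i * v $ i)) = hform H v v"
    by (subst sum.swap) (simp add: hform_def matrix_vector_mult_def sum_distrib_left)
  finally show ?thesis .
qed

lemma hform_scaleR: "hform M (c *\<^sub>R x) (c *\<^sub>R x) = of_real (c\<^sup>2) * hform M x x"
  by (simp add: hform_def matrix_vector_mult_def sum_distrib_left power2_eq_square
      scaleR_conv_of_real[where 'a=complex] mult_ac)

text \<open>Polarization: basis vectors give real diagonal entries, and
  \<open>axis i 1 + axis j t\<close> with \<open>t = 1\<close> and \<open>t = \<i>\<close> compares
  the imaginary and the real parts of opposite entries.\<close>

lemma hermitian_if_hform_real: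
  assumes "\<And>x. hform H x x \<in> \<real>"
  shows "H\<^sup>\<star> = H"
proof -
  have d: "Im (H $ i $ i) = 0" for i
    using assms[of "axis i 1"]
    by (simp add: hform_axis_left matrix_vector_mult_axis complex_is_Real_iff)
  have "cnj (H $ j $ i) = H $ i $ j" for i j
  proof -
    have e: "hform H (axis i 1 + axis j t) (axis i 1 + axis j t)
        = H $ i $ i + H $ i $ j * t + cnj t * H $ j $ i + cnj t * H $ j $ j * t" for t
      by (simp add: hform_add_left hform_add_right hform_axis_left matrix_vector_mult_axis
          algebra_simps)
    have "Im (H $ i $ j) + Im (H $ j $ i) = 0"
      using assms[of "axis i 1 + axis j 1"] unfolding e
      by (simp add: complex_is_Real_iff d)
    moreover have "Re (H $ i $ j) - Re (H $ j $ i) = 0"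
      using assms[of "axis i 1 + axis j \<i>"] unfolding e
      by (simp add: complex_is_Real_iff d)
    ultimately show ?thesis
      by (simp add: complex_eq_iff)
  qed
  then show ?thesis
    by (simp add: conj_transpose_def vec_eq_iff)
qed

text \<open>The maximizer of \<open>Re (trace (P ** M))\<close> over the unitary group gives the polar decomposition:
  comparing it with its perturbations by phase reflections yields \<open>Re (z * w) \<le> Re w\<close> for
  \<open>w = hform (P ** M) v v\<close> and all \<open>z\<close> on the unit circle, so that \<open>w \<ge> 0\<close>.\<close>

lemma polar_square:
  fixes M :: "complex^'n^'n"
  obtains P where "P \<in> unitary_group" "psd_hermitian (P ** M)"
    "\<And>Q. Q \<in> unitary_group \<Longrightarrow> Q \<bullet> M\<^sup>\<star> \<le> P \<bullet> M\<^sup>\<star>"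
proof -
  have "mat 1 \<in> (unitary_group :: (complex^'n^'n) set)"
    by (simp add: unitary_group_iff)
  then have "unitary_group \<noteq> ({} :: (complex^'n^'n) set)"
    by blast
  moreover have "continuous_on unitary_group (\<lambda>Q. Q \<bullet> M\<^sup>\<star>)"
    by (intro continuous_intros)
  ultimately obtain P :: "complex^'n^'n" where P: "P \<in> unitary_group"
    and max: "\<And>Q. Q \<in> unitary_group \<Longrightarrow> Q \<bullet> M\<^sup>\<star> \<le> P \<bullet> M\<^sup>\<star>"
    using continuous_attains_sup[OF compact_unitary_group, of "\<lambda>Q. Q \<bullet> M\<^sup>\<star>"] by blast
  define H where "H = P ** M"
  \<comment> \<open>Equality with the modulus expresses at once that the value is real and
    nonnegative.\<close>
  have unit: "hform H v v = of_real (cmod (hform H v v))" if "norm v = 1" for v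
  proof -
    define w where "w = hform H v v"
    define z where "z = (if w = 0 then 1 else cnj w / of_real (cmod w))"
    have "cmod z = 1" by (simp add: z_def norm_divide)
    have zw: "z * w = of_real (cmod w)"
      using complex_norm_square[of w] by (cases "w = 0") (simp_all add: z_def field_simps power2_eq_square)
    have "phase_reflection z v ** P \<in> unitary_group"
      by (intro unitary_group_mult P phase_reflection_unitary \<open>cmod z = 1\<close> that)
    from max[OF this] have "phase_reflection z v \<bullet> H\<^sup>\<star> \<le> mat 1 \<bullet> H\<^sup>\<star>"
      using inner_matrix_mult_right[of "mat 1" P "M\<^sup>\<star>"]
      by (simp add: inner_matrix_mult_right H_def conj_transpose_mult)
    then have "Re (z * w) \<le> Re w"
      by (simp add: inner_phase_reflection w_def left_diff_distrib del: times_complex.sel)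
    then have "cmod w \<le> Re w"
      by (simp add: zw)
    then have "Re w = cmod w"
      using complex_Re_le_cmod[of w] by simp
    then have "w = of_real (cmod w)"
      using cmod_power2[of w] by (simp add: complex_eq_iff)
    then show ?thesis by (simp add: w_def)
  qed
  have nonneg: "hform H x x = of_real (cmod (hform H x x))" for x
  proof (cases "x = 0")
    case True
    then show ?thesis by (simp add: hform_def)
  next
    case False
    define v where "v = (1 / norm x) *\<^sub>R x"
    have "norm v = 1" "x = norm x *\<^sub>R v"
      using False by (auto simp: v_def)
    then have "hform H x x = of_real ((norm x)\<^sup>2) * hform H v v"
      by (metis hform_scaleR)
    also have "\<dots> = of_real ((norm x)\<^sup>2 * cmod (hform H v v))"
      using unit[OF \<open>norm v = 1\<close>] by (metis of_real_mult)
    finally show ?thesis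
      by (simp del: of_real_mult)
  qed
  have "H\<^sup>\<star> = H"
    by (rule hermitian_if_hform_real) (metis nonneg Reals_of_real)
  moreover have "0 \<le> Re (hform H x x)" for x
    by (metis nonneg Re_complex_of_real norm_ge_zero)
  ultimately have "psd_hermitian (P ** M)"
    by (simp add: psd_hermitian_hform H_def)
  with P max that show ?thesis by blast
qed

text \<open>The coordinate inclusions of the two spaces into their direct sum, indexed by the sum
  type.\<close>

lemma isometry_embeddings:
  obtains J :: "complex^'n::finite^('n + 'l::finite)" and G :: "complex^'l^('n + 'l)"
  where "J\<^sup>\<star> ** J = mat 1" "G\<^sup>\<star> ** G = mat 1"
proof
  show "(\<chi> k i. if k = Inl i then 1 else 0 :: complex^'n^('n + 'l))\<^sup>\<star> **
      (\<chi> k i. if k = Inl i then 1 else 0) = mat 1"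
    by (simp add: conj_transpose_def matrix_matrix_mult_def mat_def vec_eq_iff
        if_distrib[of cnj] if_distrib[of "\<lambda>z. z * _"] cong: if_cong)
  show "(\<chi> k i. if k = Inr i then 1 else 0 :: complex^'l^('n + 'l))\<^sup>\<star> **
      (\<chi> k i. if k = Inr i then 1 else 0) = mat 1"
    by (simp add: conj_transpose_def matrix_matrix_mult_def mat_def vec_eq_iff
        if_distrib[of cnj] if_distrib[of "\<lambda>z. z * _"] cong: if_cong)
qed

text \<open>A rectangular matrix is embedded into a square one, whose polar decomposition is compressed
  back.\<close>

lemma polar_rectangular:
  fixes A :: "complex^'l^'n"
  obtains S :: "complex^'l^'l" and U :: "complex^'l^'n"
  where "psd_hermitian S" "S ** S = A\<^sup>\<star> ** A" "A = U ** S" "S = U\<^sup>\<star> ** A" "contraction U"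
proof -
  obtain J :: "complex^'n^('n + 'l)" and G :: "complex^'l^('n + 'l)"
    where J: "J\<^sup>\<star> ** J = mat 1" and G: "G\<^sup>\<star> ** G = mat 1"
    by (rule isometry_embeddings)
  define X where "X = J ** A ** G\<^sup>\<star>"
  obtain P where P: "P \<in> unitary_group" and H: "psd_hermitian (P ** X)"
    by (rule polar_square)
  define H where "H = P ** X"
  have H_herm: "H\<^sup>\<star> = H"
    using H by (simp add: H_def psd_hermitian_hform)
  have P1: "P\<^sup>\<star> ** P = mat 1" "P ** P\<^sup>\<star> = mat 1"
    using P by (simp_all add: unitary_group_def)
  have XG: "X ** G = J ** A"
    unfolding X_def by (metis G matrix_mul_assoc matrix_mul_rid)
  \<comment> \<open>\<open>X\<close> ends in \<open>G\<^sup>\<star>\<close>, so \<open>H\<close>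
    absorbs the projection \<open>G ** G\<^sup>\<star>\<close> on the right; being hermitian, it
    also does so on the left.\<close>
  have HGG: "H ** G ** G\<^sup>\<star> = H"
    unfolding H_def X_def by (metis G matrix_mul_assoc matrix_mul_rid)
  have GGH: "G ** G\<^sup>\<star> ** H = H"
    using arg_cong[OF HGG, of conj_transpose] by (simp add: conj_transpose_mult H_herm matrix_mul_assoc)
  \<comment> \<open>The square decomposition is \<open>X = P\<^sup>\<star> ** H\<close>;
    \<open>S\<close> and \<open>U\<close> are compressions of its two factors.\<close>
  define S where "S = G\<^sup>\<star> ** H ** G"
  define U where "U = J\<^sup>\<star> ** P\<^sup>\<star> ** G"
  show ?thesis
  proof
    show "psd_hermitian S"
      unfolding S_def H_def by (rule psd_hermitian_congruence[OF H])
    have "S ** S = G\<^sup>\<star> ** H ** (G ** G\<^sup>\<star> ** H) ** G"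
      by (simp add: S_def matrix_mul_assoc)
    also have "\<dots> = G\<^sup>\<star> ** H\<^sup>\<star> ** H ** G"
      by (simp only: GGH H_herm)
    also have "\<dots> = (X ** G)\<^sup>\<star> ** (P\<^sup>\<star> ** P) ** (X ** G)"
      by (simp add: H_def conj_transpose_mult matrix_mul_assoc)
    also have "\<dots> = A\<^sup>\<star> ** (J\<^sup>\<star> ** J) ** A"
      by (simp add: P1 XG conj_transpose_mult matrix_mul_assoc)
    finally show "S ** S = A\<^sup>\<star> ** A"
      by (simp add: J)
    have "U ** S = J\<^sup>\<star> ** P\<^sup>\<star> ** (G ** G\<^sup>\<star> ** H) ** G"
      by (simp add: S_def U_def matrix_mul_assoc)
    also have "\<dots> = J\<^sup>\<star> ** (P\<^sup>\<star> ** P) ** (X ** G)"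
      by (simp only: GGH) (simp add: H_def matrix_mul_assoc)
    also have "\<dots> = (J\<^sup>\<star> ** J) ** A"
      by (simp add: P1 XG matrix_mul_assoc)
    finally show "A = U ** S"
      by (simp add: J)
    have "U\<^sup>\<star> ** A = G\<^sup>\<star> ** P ** (J ** A)"
      by (simp add: U_def conj_transpose_mult matrix_mul_assoc)
    also have "\<dots> = S"
      by (simp add: XG[symmetric] S_def H_def matrix_mul_assoc)
    finally show "S = U\<^sup>\<star> ** A" ..
    show "contraction U"
      unfolding U_def
      using contraction_isometry[of "J\<^sup>\<star>"] contraction_isometry[of "P\<^sup>\<star>"] J P1
        contraction_conj_transpose[OF contraction_isometry[of "G\<^sup>\<star>"]] G
      by (intro contraction_mult) simp_all
  qed
qed

section \<open>The matrix \<open>phi_C A\<close> as polar factor, and unitary invariance\<close>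

lemma psd_sqrt_eqI:
  assumes "psd_hermitian S" "S ** S = M" shows "psd_sqrt M = S"
  unfolding psd_sqrt_def
  by (rule the_equality) (use assms psd_hermitian_square_unique in auto)

lemma phi_C_polar:
  fixes A :: "complex^'l^'n"
  obtains U :: "complex^'l^'n"
  where "psd_hermitian (phi_C A)" "phi_C A ** phi_C A = A\<^sup>\<star> ** A"
    "A = U ** phi_C A" "phi_C A = U\<^sup>\<star> ** A" "contraction U"
proof -
  obtain S :: "complex^'l^'l" and U :: "complex^'l^'n"
    where *: "psd_hermitian S" "S ** S = A\<^sup>\<star> ** A" "A = U ** S" "S = U\<^sup>\<star> ** A" "contraction U"
    by (rule polar_rectangular)
  then have "phi_C A = S"
    unfolding phi_C_def by (intro psd_sqrt_eqI)
  show ?thesis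
    by (rule that[of U, unfolded \<open>phi_C A = S\<close>]) (fact *)+
qed

lemma phi_C_hermitian: "(phi_C A)\<^sup>\<star> = phi_C A"
  by (rule phi_C_polar[of A]) (simp only: psd_hermitian_hform)

lemma phi_C_square: "phi_C A ** phi_C A = A\<^sup>\<star> ** A"
  by (rule phi_C_polar[of A])

lemma phi_C_unitary:
  assumes "P \<in> unitary_group" shows "phi_C (P ** A) = phi_C A"
proof -
  have "(P ** A)\<^sup>\<star> ** (P ** A) = A\<^sup>\<star> ** (P\<^sup>\<star> ** P) ** A"
    by (simp add: conj_transpose_mult matrix_mul_assoc)
  with assms show ?thesis
    by (simp add: unitary_group_def phi_C_def)
qed

lemma inner_self_eq_gram: "A \<bullet> A = mat 1 \<bullet> (A\<^sup>\<star> ** A)"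
  using inner_matrix_mult_left[of A "mat 1" A] by simp

lemma norm_phi_C: "norm (phi_C A) = norm A"
  by (simp add: norm_eq_sqrt_inner inner_self_eq_gram phi_C_hermitian phi_C_square)

lemma norm_unitary_mult: "P \<in> unitary_group \<Longrightarrow> norm (P ** A) = norm A"
  using norm_phi_C[of "P ** A"] norm_phi_C[of A] by (simp add: phi_C_unitary)

lemma norm_contraction_mult:
  assumes "contraction W" shows "norm (W ** X) \<le> norm X"
  using norm_mult_contraction[OF contraction_conj_transpose[OF assms], of "X\<^sup>\<star>"]
  by (simp flip: conj_transpose_mult)

lemma unitary_group_contraction: "P \<in> unitary_group \<Longrightarrow> contraction P"
  by (simp add: contraction_isometry unitary_group_iff)

lemma norm_diff_square: "(norm (X - Y))\<^sup>2 = (norm X)\<^sup>2 + (norm Y)\<^sup>2 - 2 * (X \<bullet> Y)"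
  for X :: "'a::real_inner"
  by (simp add: power2_norm_eq_inner inner_diff inner_commute)

text \<open>Brings the pairing into the form of the functional maximized in
  \<open>polar_square\<close>, with \<open>M = X ** Y\<^sup>\<star>\<close>.\<close>

lemma inner_unitary_mult: "(Q ** X) \<bullet> Y = Q \<bullet> (X ** Y\<^sup>\<star>)\<^sup>\<star>"
  by (simp add: inner_matrix_mult_right conj_transpose_mult)

subsection \<open>The two distance estimates without translations\<close>

text \<open>The left side is \<open>(W ** A) \<bullet> B\<close> at the contraction
  \<open>W = V ** U\<^sup>\<star>\<close>. Factoring the positive matrix as
  \<open>Y ** Y\<^sup>\<star>\<close> turns this pairing into
  \<open>(W ** P\<^sup>\<star> ** Y) \<bullet> Y\<close>, at most the squared norm of
  \<open>Y\<close>, which is the value at \<open>W = P\<close>.\<close>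

lemma inner_phi_C_le:
  fixes A B :: "complex^'l^'n"
  assumes P: "P \<in> unitary_group" and H: "psd_hermitian (P ** (A ** B\<^sup>\<star>))"
  shows "phi_C A \<bullet> phi_C B \<le> (P ** A) \<bullet> B"
proof -
  obtain U where U: "phi_C A = U\<^sup>\<star> ** A" "contraction U" by (rule phi_C_polar[of A])
  obtain V where V: "phi_C B = V\<^sup>\<star> ** B" "contraction V" by (rule phi_C_polar[of B])
  obtain Y :: "complex^'n^'n" where Y: "P ** (A ** B\<^sup>\<star>) = Y ** Y\<^sup>\<star>"
    using psd_hermitian_cholesky[OF H] by blast
  have "A ** B\<^sup>\<star> = P\<^sup>\<star> ** (Y ** Y\<^sup>\<star>)"
    unfolding Y[symmetric] using P by (simp add: matrix_mul_assoc unitary_group_def)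
  then have M: "B ** A\<^sup>\<star> = Y ** Y\<^sup>\<star> ** P"
    by (metis conj_transpose_conj_transpose conj_transpose_mult)
  have W: "(W ** A) \<bullet> B = (W ** P\<^sup>\<star> ** Y) \<bullet> Y" for W
    by (simp add: inner_matrix_mult_right M conj_transpose_mult matrix_mul_assoc)
  have "phi_C A \<bullet> phi_C B = ((V ** U\<^sup>\<star>) ** A) \<bullet> B"
    by (simp add: U(1) V(1) inner_matrix_mult_left conj_transpose_mult matrix_mul_assoc)
  also have "\<dots> = ((V ** U\<^sup>\<star> ** P\<^sup>\<star>) ** Y) \<bullet> Y"
    by (rule W)
  also have "\<dots> \<le> norm ((V ** U\<^sup>\<star> ** P\<^sup>\<star>) ** Y) * norm Y"
    by (rule norm_cauchy_schwarz)
  also have "\<dots> \<le> norm Y * norm Y"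
    by (intro mult_right_mono norm_contraction_mult contraction_mult contraction_conj_transpose
        unitary_group_contraction U V P norm_ge_zero)
  also have "\<dots> = (P ** A) \<bullet> B"
    using P by (simp add: W unitary_group_def power2_norm_eq_inner flip: power2_eq_square)
  finally show ?thesis .
qed

text \<open>With polar decompositions \<open>A = U ** S\<close> and \<open>B = V ** T\<close>, Cauchy-Schwarz bounds
  \<open>2 * (A \<bullet> B)\<close> by \<open>S \<bullet> T\<close> plus the inner product of \<open>U ** S ** U\<^sup>\<star>\<close> and \<open>V ** T ** V\<^sup>\<star>\<close>.\<close>

lemma norm_phi_C_diff_le:
  fixes A B :: "complex^'l^'n"
  shows "norm (phi_C A - phi_C B) \<le> sqrt 2 * norm (A - B)"
proof -
  define S where "S = phi_C A"
  define T where "T = phi_C B"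
  obtain U where S: "psd_hermitian S" and U: "A = U ** S" "contraction U"
    unfolding S_def by (rule phi_C_polar[of A])
  obtain V where T: "psd_hermitian T" and V: "B = V ** T" "contraction V"
    unfolding T_def by (rule phi_C_polar[of B])
  obtain Y :: "complex^'l^'l" where Y: "S = Y ** Y\<^sup>\<star>" using psd_hermitian_cholesky[OF S] by blast
  obtain Z :: "complex^'l^'l" where Z: "T = Z ** Z\<^sup>\<star>" using psd_hermitian_cholesky[OF T] by blast
  \<comment> \<open>Chosen so that \<open>X \<bullet> X'\<close> is \<open>A \<bullet> B\<close>,
    while \<open>X' \<bullet> X'\<close> and \<open>X \<bullet> X\<close> are the two inner products
    in the bound.\<close>
  define X where "X = Y\<^sup>\<star> ** U\<^sup>\<star> ** V ** Z"
  define X' where "X' = Y\<^sup>\<star> ** Z"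
  have T_herm: "T\<^sup>\<star> = T"
    using T by (simp add: psd_hermitian_hform)
  have "A \<bullet> B = X \<bullet> X'"
  proof -
    have "B \<bullet> A = (V ** Z) \<bullet> (U ** Y ** Y\<^sup>\<star> ** Z)"
      by (simp add: U(1) V(1) Y Z inner_matrix_mult_right matrix_mul_assoc)
    also have "\<dots> = (U ** Y ** X') \<bullet> (V ** Z)"
      by (simp add: X'_def inner_commute matrix_mul_assoc)
    also have "\<dots> = X' \<bullet> X"
      by (simp add: X_def inner_matrix_mult_left[of "U ** Y"] conj_transpose_mult matrix_mul_assoc)
    finally show ?thesis by (simp add: inner_commute)
  qed
  moreover have "2 * (X \<bullet> X') \<le> X \<bullet> X + X' \<bullet> X'"
    using inner_ge_zero[of "X - X'"] by (simp add: inner_diff inner_commute)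
  moreover have "X' \<bullet> X' = S \<bullet> T"
  proof -
    have "X' \<bullet> X' = (S ** Z) \<bullet> Z"
      by (simp add: X'_def Y inner_matrix_mult_left[of "Y\<^sup>\<star>"] inner_commute matrix_mul_assoc)
    then show ?thesis by (simp add: Z inner_matrix_mult_right)
  qed
  moreover have "X \<bullet> X = (A ** U\<^sup>\<star>) \<bullet> (B ** V\<^sup>\<star>)"
  proof -
    have "X \<bullet> X = (Y\<^sup>\<star> ** (U\<^sup>\<star> ** V)) \<bullet> (Y\<^sup>\<star> ** (U\<^sup>\<star> ** V ** T))"
      by (simp add: X_def Z inner_matrix_mult_right[of _ Z] matrix_mul_assoc)
    also have "\<dots> = (U\<^sup>\<star> ** V) \<bullet> (S ** U\<^sup>\<star> ** V ** T)"
      by (simp only: inner_matrix_mult_left[of "Y\<^sup>\<star>"]) (simp add: Y matrix_mul_assoc)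
    also have "\<dots> = (A ** U\<^sup>\<star> ** (V ** T)) \<bullet> V"
      by (simp add: inner_matrix_mult_left[of "U\<^sup>\<star>"] U(1)[symmetric] inner_commute matrix_mul_assoc)
    also have "\<dots> = (A ** U\<^sup>\<star>) \<bullet> (V ** T ** V\<^sup>\<star>)"
      by (simp only: inner_matrix_mult_right conj_transpose_mult T_herm matrix_mul_assoc)
    finally show ?thesis by (simp flip: V(1))
  qed
  moreover have "2 * ((A ** U\<^sup>\<star>) \<bullet> (B ** V\<^sup>\<star>)) \<le> (norm (A ** U\<^sup>\<star>))\<^sup>2 + (norm (B ** V\<^sup>\<star>))\<^sup>2"
    using norm_diff_square[of "A ** U\<^sup>\<star>" "B ** V\<^sup>\<star>"] zero_le_power2[of "norm (A ** U\<^sup>\<star> - B ** V\<^sup>\<star>)"]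
    by linarith
  moreover have "(norm (A ** U\<^sup>\<star>))\<^sup>2 \<le> (norm A)\<^sup>2"
    by (intro power_mono norm_mult_contraction contraction_conj_transpose U norm_ge_zero)
  moreover have "(norm (B ** V\<^sup>\<star>))\<^sup>2 \<le> (norm B)\<^sup>2"
    by (intro power_mono norm_mult_contraction contraction_conj_transpose V norm_ge_zero)
  moreover have "(norm (S - T))\<^sup>2 = (norm A)\<^sup>2 + (norm B)\<^sup>2 - 2 * (S \<bullet> T)"
    by (simp add: norm_diff_square S_def T_def norm_phi_C)
  \<comment> \<open>With \<open>a\<close> and \<open>b\<close> the squared norms of \<open>A\<close>
    and \<open>B\<close>, the facts give
    \<open>2 * (A \<bullet> B) \<le> S \<bullet> T + (a + b) / 2\<close>; inserting this into the
    expansion of the left side yields the factor 2.\<close>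
  ultimately have "(norm (S - T))\<^sup>2 \<le> 2 * (norm (A - B))\<^sup>2"
    using norm_diff_square[of A B] by linarith
  then have "norm (S - T) \<le> sqrt (2 * (norm (A - B))\<^sup>2)"
    by (rule real_le_rsqrt)
  then show ?thesis
    by (simp add: S_def T_def real_sqrt_mult)
qed

subsection \<open>Translations\<close>

text \<open>The orthogonal projection onto the vectors with coordinate sum zero.\<close>

definition centering :: "complex^'l^'l" where
  "centering = (\<chi> i j. (if i = j then 1 else 0) - 1 / of_nat CARD('l))"

lemma mult_centering:
  "A ** centering = A - (\<chi> i j. column_mean A $ i)" for A :: "complex^'l^'n"
  by (simp add: vec_eq_iff matrix_matrix_mult_def centering_def column_mean_def column_def
      right_diff_distrib sum_subtractf if_distrib[of "(*) _"] sum_divide_distrib scaleR_conv_of_real[where 'a=complex]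
      cong: if_cong)

lemma psi_C_eq: "psi_C A = phi_C (A ** centering)"
  unfolding psi_C_def mult_centering
  by (rule arg_cong[of _ _ phi_C]) (simp add: vec_eq_iff column_def)

lemma row_constant_mult_centering: "(\<chi> i j. q $ i) ** centering = 0"
  by (simp add: vec_eq_iff matrix_matrix_mult_def centering_def right_diff_distrib sum_subtractf
      if_distrib[of "(*) _"] cong: if_cong)

lemma centering_hermitian: "centering\<^sup>\<star> = centering"
  by (auto simp: centering_def conj_transpose_def vec_eq_iff)

lemma centering_idem: "centering ** centering = centering"
  unfolding mult_centering[of centering]
  by (simp add: vec_eq_iff column_mean_def column_def centering_def sum_subtractf)

lemma contraction_centering: "contraction centering"
  unfolding contraction_def
proof
  fix x :: "complex^'l"
  let ?y = "x v* centering"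
  have "norm ?y * norm ?y = x \<bullet> ?y"
    using inner_vector_matrix_mult[of x centering ?y]
    by (simp add: vector_matrix_mul_assoc centering_hermitian centering_idem dot_square_norm power2_eq_square)
  also have "\<dots> \<le> norm x * norm ?y"
    by (rule norm_cauchy_schwarz)
  finally show "norm ?y \<le> norm x"
    by (cases "norm ?y = 0") (auto dest: mult_right_le_imp_le)
qed

lemma mat_action_eq: "mat_action (P, q) A = P ** A + (\<chi> i j. q $ i)"
  by (simp add: mat_action_def vec_action_def vec_eq_iff matrix_matrix_mult_def
      matrix_vector_mult_def column_def)

text \<open>Right multiplication by \<open>centering\<close> removes every translation and does not
  increase the norm, so only the unitary part remains to be optimized. Exhibiting a minimizer also
  settles that the \<open>LEAST\<close> is attained.\<close>

lemma euclidean_dist_eq: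
  fixes A B :: "complex^'l^'n"
  defines "X \<equiv> A ** centering" and "Y \<equiv> B ** centering"
  assumes P: "P \<in> unitary_group"
    and max: "\<And>Q. Q \<in> unitary_group \<Longrightarrow> Q \<bullet> (X ** Y\<^sup>\<star>)\<^sup>\<star> \<le> P \<bullet> (X ** Y\<^sup>\<star>)\<^sup>\<star>"
  shows "euclidean_dist A B = norm (P ** X - Y)"
  unfolding euclidean_dist_def mat_norm_eq_norm
proof (rule Least_equality)
  \<comment> \<open>The translation carries the column mean of \<open>P ** A\<close> to that of
    \<open>B\<close>.\<close>
  let ?g = "(P, column_mean B - P *v column_mean A)"
  have "mat_action ?g A - B = P ** X - Y"
    unfolding mat_action_eq X_def Y_def mult_centering matrix_diff_ldistrib
    by (simp add: vec_eq_iff matrix_matrix_mult_def matrix_vector_mult_def)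
  moreover have "?g \<in> complex_euclidean_group"
    using P by (simp add: complex_euclidean_group_def)
  ultimately show "\<exists>g\<in>complex_euclidean_group. norm (P ** X - Y) = norm (mat_action g A - B)"
    by metis
next
  fix r
  assume "\<exists>g\<in>complex_euclidean_group. r = norm (mat_action g A - B)"
  then obtain Q q where Q: "Q \<in> unitary_group" and r: "r = norm (mat_action (Q, q) A - B)"
    by (auto simp: complex_euclidean_group_def)
  \<comment> \<open>In the expanded squares only the inner product depends on the unitary
    factor.\<close>
  have "(norm (P ** X - Y))\<^sup>2 \<le> (norm (Q ** X - Y))\<^sup>2"
    using max[OF Q] P Q by (simp add: norm_diff_square norm_unitary_mult inner_unitary_mult)
  then have "norm (P ** X - Y) \<le> norm (Q ** X - Y)"
    by (rule power2_le_imp_le) simp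
  also have "Q ** X - Y = (mat_action (Q, q) A - B) ** centering"
    by (simp add: mat_action_eq X_def Y_def matrix_diff_rdistrib matrix_add_rdistrib
        row_constant_mult_centering matrix_mul_assoc)
  also have "norm \<dots> \<le> r"
    unfolding r by (rule norm_mult_contraction[OF contraction_centering])
  finally show "norm (P ** X - Y) \<le> r" .
qed

text \<open>One unitary \<open>P\<close> serves both bounds: it realizes the distance and makes
  \<open>P ** (X ** Y\<^sup>\<star>)\<close> positive semi-definite. For the upper bound,
  \<open>phi_C\<close> is unchanged when \<open>X\<close> is replaced by
  \<open>P ** X\<close>.\<close>

lemma psi_C_bounds:
  fixes A B :: "complex^'l^'n"
  shows
  "euclidean_dist A B \<le> mat_dist (psi_C A) (psi_C B)"
  "mat_dist (psi_C A) (psi_C B) \<le> sqrt 2 * euclidean_dist A B"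
proof -
  define X where "X = A ** centering"
  define Y where "Y = B ** centering"
  obtain P :: "complex^'n^'n" where P: "P \<in> unitary_group" and H: "psd_hermitian (P ** (X ** Y\<^sup>\<star>))"
    and max: "\<And>Q. Q \<in> unitary_group \<Longrightarrow> Q \<bullet> (X ** Y\<^sup>\<star>)\<^sup>\<star> \<le> P \<bullet> (X ** Y\<^sup>\<star>)\<^sup>\<star>"
    using polar_square[of "X ** Y\<^sup>\<star>"] by blast
  have e: "euclidean_dist A B = norm (P ** X - Y)"
    using euclidean_dist_eq[of P A B] P max by (simp add: X_def Y_def)
  have d: "mat_dist (psi_C A) (psi_C B) = norm (phi_C X - phi_C Y)"
    by (simp add: mat_dist_def mat_norm_eq_norm psi_C_eq X_def Y_def)
  have "(norm (P ** X - Y))\<^sup>2 \<le> (norm (phi_C X - phi_C Y))\<^sup>2"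
    using inner_phi_C_le[OF P H] P by (simp add: norm_diff_square norm_phi_C norm_unitary_mult)
  then show "euclidean_dist A B \<le> mat_dist (psi_C A) (psi_C B)"
    unfolding e d by (rule power2_le_imp_le) simp
  show "mat_dist (psi_C A) (psi_C B) \<le> sqrt 2 * euclidean_dist A B"
    unfolding e d using norm_phi_C_diff_le[of "P ** X" Y] P by (simp add: phi_C_unitary)
qed

subsection \<open>The dimension of the image\<close>

text \<open>The Gram matrix \<open>S ** S\<close> absorbs \<open>centering\<close>. This passes to
  the root \<open>S\<close> because the defect \<open>Y\<close> has Gram matrix zero.\<close>

lemma psi_C_mult_centering: "psi_C A ** centering = psi_C A"
proof -
  define S where "S = psi_C A"
  define Y where "Y = S - S ** centering"
  have S: "S\<^sup>\<star> = S" "S ** S = (A ** centering)\<^sup>\<star> ** (A ** centering)"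
    by (simp_all add: S_def psi_C_eq phi_C_hermitian phi_C_square)
  have SS: "S ** S ** centering = S ** S"
    unfolding S(2) by (simp add: centering_idem flip: matrix_mul_assoc)
  have "Y\<^sup>\<star> ** Y = S ** S - S ** S ** centering
      - centering ** (S ** S - S ** S ** centering)"
    by (simp add: Y_def conj_transpose_diff conj_transpose_mult S(1) centering_hermitian
        matrix_diff_ldistrib matrix_diff_rdistrib matrix_mul_assoc)
  then have "Y\<^sup>\<star> ** Y = 0"
    by (simp add: SS)
  then have "Y = 0"
    by (rule conj_transpose_mult_self_eq_0)
  then show ?thesis
    by (simp add: Y_def S_def)
qed

lemma psi_C_hermitian: "(psi_C A)\<^sup>\<star> = psi_C A"
  by (simp add: psi_C_eq phi_C_hermitian)

lemma psi_C_row_sum: "(\<Sum>j\<in>UNIV. psi_C A $ i $ j) = 0"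
proof -
  have "column_mean (psi_C A) $ i = 0"
    using psi_C_mult_centering[of A] unfolding mult_centering by (simp add: vec_eq_iff)
  then show ?thesis
    by (simp add: column_mean_def column_def)
qed

text \<open>A hermitian matrix corresponds to the real matrix with entries \<open>Re + Im\<close>: the real part is
  its symmetric and the imaginary part its antisymmetric part. Row and column \<open>k\<close> are then
  determined by the vanishing of all row and column sums.\<close>

definition balanced_hermitian :: "'l \<Rightarrow> real^'l^'l \<Rightarrow> complex^'l^'l" where
  "balanced_hermitian k F =
    (let f = (\<lambda>i j. F $ i $ j - of_bool (i = k) * (\<Sum>m\<in>UNIV. F $ m $ j)
          - of_bool (j = k) * (\<Sum>m\<in>UNIV. F $ i $ m)
          + of_bool (i = k) * of_bool (j = k) * (\<Sum>n\<in>UNIV. \<Sum>m\<in>UNIV. F $ m $ n))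
     in \<chi> i j. Complex ((f i j + f j i) / 2) ((f i j - f j i) / 2))"

text \<open>Coordinates inverse to \<open>balanced_hermitian\<close>; the redundant pivot row and
  column are filled with zeros, which avoids a smaller index type.\<close>

definition off_pivot :: "'l \<Rightarrow> complex^'l^'l \<Rightarrow> real^'l^'l" where
  "off_pivot k H = (\<chi> i j. if i = k \<or> j = k then 0 else Re (H $ i $ j) + Im (H $ i $ j))"

lemma linear_balanced_hermitian: "linear (balanced_hermitian k)"
  by (rule linearI)
    (simp_all add: balanced_hermitian_def Let_def vec_eq_iff complex_eq_iff sum.distrib
      flip: sum_distrib_left, simp_all add: field_simps)

lemma off_pivot_balanced_hermitian:
  assumes "\<And>i j. i = k \<or> j = k \<Longrightarrow> F $ i $ j = 0"
  shows "off_pivot k (balanced_hermitian k F) = F"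
  using assms by (auto simp: off_pivot_def balanced_hermitian_def Let_def vec_eq_iff field_simps)

lemma sum_if_neq: "(\<Sum>m\<in>UNIV. if m = k then 0 else g m) = (\<Sum>m\<in>UNIV. g m) - g k"
  for g :: "'l::finite \<Rightarrow> 'a::ab_group_add"
  by (simp add: sum.remove[of UNIV k])

text \<open>The row and column sums of \<open>f\<close> vanish, so its pivot row and column are
  negated sums of the other entries, and the pivot entry is the total of all entries off the
  pivot.\<close>

lemma balanced_hermitian_off_pivot:
  assumes "H\<^sup>\<star> = H" "\<And>i. (\<Sum>j\<in>UNIV. H $ i $ j) = 0"
  shows "balanced_hermitian k (off_pivot k H) = H"
proof -
  define f where "f = (\<lambda>i j. Re (H $ i $ j) + Im (H $ i $ j))"
  have H: "Re (H $ j $ i) = Re (H $ i $ j)" "Im (H $ j $ i) = - Im (H $ i $ j)" for i j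
    using hermitian_nth[OF assms(1), of i j] by (simp_all add: complex_eq_iff)
  have sums: "(\<Sum>j\<in>UNIV. Re (H $ i $ j)) = 0" "(\<Sum>j\<in>UNIV. Im (H $ i $ j)) = 0" for i
    using assms(2)[of i] by (simp_all add: complex_eq_iff)
  have row: "(\<Sum>j\<in>UNIV. f i j) = 0" for i
    by (simp add: f_def sum.distrib sums)
  \<comment> \<open>Transposition only changes the sign of the imaginary part, so column sums reduce
    to row sums.\<close>
  have col: "(\<Sum>i\<in>UNIV. f i j) = 0" for j
    by (simp add: f_def sum.distrib H[of _ j] sum_subtractf sums)
  have P: "off_pivot k H $ i $ j = (if i = k then 0 else if j = k then 0 else f i j)" for i j
    by (simp add: off_pivot_def f_def)
  have rowP: "(\<Sum>j\<in>UNIV. off_pivot k H $ i $ j) = (if i = k then 0 else - f i k)" for i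
    by (simp add: P sum_if_neq row)
  have colP: "(\<Sum>i\<in>UNIV. off_pivot k H $ i $ j) = (if j = k then 0 else - f k j)" for j
    by (simp add: P sum_if_neq col)
  have total: "(\<Sum>j\<in>UNIV. \<Sum>i\<in>UNIV. off_pivot k H $ i $ j) = f k k"
    by (simp add: colP sum_if_neq row sum_negf)
  have "off_pivot k H $ i $ j - of_bool (i = k) * (\<Sum>m\<in>UNIV. off_pivot k H $ m $ j)
      - of_bool (j = k) * (\<Sum>m\<in>UNIV. off_pivot k H $ i $ m)
      + of_bool (i = k) * of_bool (j = k) * (\<Sum>n\<in>UNIV. \<Sum>m\<in>UNIV. off_pivot k H $ m $ n)
      = f i j" for i j
    unfolding total unfolding rowP colP by (simp add: P)
  moreover have "Complex ((f i j + f j i) / 2) ((f i j - f j i) / 2) = H $ i $ j" for i j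
    using H[of j i] by (simp add: f_def complex_eq_iff)
  ultimately show ?thesis
    by (simp add: balanced_hermitian_def Let_def vec_eq_iff)
qed

text \<open>The subspace is the injective linear image of the real matrices supported off row and
  column \<open>k\<close>, which have one free entry for each pair of indices different from
  \<open>k\<close>.\<close>

lemma balanced_hermitian_subspace:
  obtains S :: "(complex^'l^'l) set"
  where "subspace S" "dim S = (CARD('l) - 1)\<^sup>2"
    "\<And>H. H\<^sup>\<star> = H \<Longrightarrow> (\<And>i. (\<Sum>j\<in>UNIV. H $ i $ j) = 0) \<Longrightarrow> H \<in> S"
proof -
  \<comment> \<open>Any index may serve as the pivot.\<close>
  obtain k :: 'l where True by blast
  define d :: "(real^'l^'l) set"
    where "d = (\<lambda>(i, j). axis i (axis j 1)) ` ((UNIV - {k}) \<times> (UNIV - {k}))"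
  define D where "D = {F :: real^'l^'l. \<forall>b\<in>Basis. b \<notin> d \<longrightarrow> F \<bullet> b = 0}"
  have inj: "inj_on (\<lambda>(i, j). axis i (axis j (1::real)) :: real^'l^'l) X" for X
    by (auto simp: inj_on_def axis_eq_axis)
  have "card d = (CARD('l) - 1)\<^sup>2"
    by (simp add: d_def card_image[OF inj] card_cartesian_product card_Diff_singleton power2_eq_square)
  moreover have "d \<subseteq> Basis"
    by (auto simp: d_def Basis_vec_def)
  ultimately have dim_D: "dim D = (CARD('l) - 1)\<^sup>2"
    unfolding D_def by (simp add: dim_substandard)
  have sub_D: "subspace D"
    unfolding D_def by (rule subspace_substandard)
  have D_iff: "F \<in> D \<longleftrightarrow> (\<forall>i j. i = k \<or> j = k \<longrightarrow> F $ i $ j = 0)" for F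
  proof -
    have "F \<in> D \<longleftrightarrow> (\<forall>i j. axis i (axis j 1) \<notin> d \<longrightarrow> F $ i $ j = 0)"
      by (auto simp: D_def Basis_vec_def inner_axis)
    also have "\<dots> \<longleftrightarrow> (\<forall>i j. i = k \<or> j = k \<longrightarrow> F $ i $ j = 0)"
      by (auto simp: d_def axis_eq_axis image_iff)
    finally show ?thesis .
  qed
  define S where "S = balanced_hermitian k ` D"
  have "inj_on (balanced_hermitian k) D"
    by (intro inj_on_inverseI[of _ "off_pivot k"] off_pivot_balanced_hermitian) (use D_iff in blast)
  then have "dim S = dim D"
    unfolding S_def
    by (intro dim_image_eq linear_balanced_hermitian) (simp add: span_eq_iff[THEN iffD2, OF sub_D])
  show ?thesis
  proof
    show "subspace S"
      unfolding S_def by (intro linear_subspace_image linear_balanced_hermitian sub_D)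
    show "dim S = (CARD('l) - 1)\<^sup>2"
      by (simp add: \<open>dim S = dim D\<close> dim_D)
    show "H \<in> S" if "H\<^sup>\<star> = H" "\<And>i. (\<Sum>j\<in>UNIV. H $ i $ j) = 0" for H
    proof -
      have "H = balanced_hermitian k (off_pivot k H)"
        using balanced_hermitian_off_pivot[OF that] by simp
      moreover have "off_pivot k H \<in> D"
        by (simp add: D_iff off_pivot_def)
      ultimately show ?thesis
        unfolding S_def by blast
    qed
  qed
qed

theorem theorem6:
  shows "(\<forall>A B :: complex ^ 'l ^ 'n.
            euclidean_dist A B \<le> mat_dist (psi_C A) (psi_C B) \<and>
            mat_dist (psi_C A) (psi_C B) \<le> sqrt 2 * euclidean_dist A B) \<and>
         (\<exists>S :: (complex ^ 'l ^ 'l) set.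
            subspace S \<and> dim S = (CARD('l) - 1)\<^sup>2 \<and>
            range (psi_C :: complex ^ 'l ^ 'n \<Rightarrow> complex ^ 'l ^ 'l) \<subseteq> S)"
proof (intro conjI)
  show "\<forall>A B :: complex ^ 'l ^ 'n.
      euclidean_dist A B \<le> mat_dist (psi_C A) (psi_C B) \<and>
      mat_dist (psi_C A) (psi_C B) \<le> sqrt 2 * euclidean_dist A B"
    by (intro allI conjI psi_C_bounds)
  obtain S :: "(complex ^ 'l ^ 'l) set" where S: "subspace S" "dim S = (CARD('l) - 1)\<^sup>2"
    "\<And>H. H\<^sup>\<star> = H \<Longrightarrow> (\<And>i. (\<Sum>j\<in>UNIV. H $ i $ j) = 0) \<Longrightarrow> H \<in> S"
    using balanced_hermitian_subspace by blast
  have "range (psi_C :: complex ^ 'l ^ 'n \<Rightarrow> complex ^ 'l ^ 'l) \<subseteq> S"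
    using S(3) psi_C_hermitian psi_C_row_sum by blast
  with S show "\<exists>S :: (complex ^ 'l ^ 'l) set.
      subspace S \<and> dim S = (CARD('l) - 1)\<^sup>2 \<and>
      range (psi_C :: complex ^ 'l ^ 'n \<Rightarrow> complex ^ 'l ^ 'l) \<subseteq> S"
    by blast
qed

end
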